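(* Let $f(n)$ be an arithmetic function for which a (nonlinear) asymptotic with a remainder term is known: $$\sum_{n\le x} f(n)=g_1(x)+O(g_2(x)),\qquad x\to\infty.$$ Then $$\sum_{n\le x} n f(n)=x g_1(x)+O(x g_2(x))-\int_1^x g_1(t)\,dt+O\left(\int_1^x g_2(t)\,dt\right),\qquad x\to\infty.$$
   Context: An arithmetic function is a function defined on the positive integers with complex values. Sums $\sum_{n\le x}$ run over positive integers $n\le x$. Here $g_1$ is the function giving the main term and $g_2$ the function in the remainder term. An asymptotic of the form $\sum_{n\le x} f(n)=cx+o(x)$ with $c$ a constant is called linear; other asymptotics are called nonlinear. $O(\cdot)$ is the usual Landau symbol as $x\to\infty$.
   Formalization: Added assumptions: g_1 and g_2 are integrable on every [1,x], g_2 is eventually nonnegative, and the integral of g_2 from 1 to x is eventually positive; otherwise the claim fails, e.g. f=0, g_1 the indicator of [1,2], g_2=0. *)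

theory Defs
  imports "HOL-Analysis.Analysis" "HOL-Library.Landau_Symbols"
begin

text \<open>
  Arithmetic functions are rendered as functions on \<open>nat\<close>; their value at \<open>0\<close> is never used.
\<close>

definition summatory :: "(nat \<Rightarrow> complex) \<Rightarrow> real \<Rightarrow> complex" where
  "summatory f x = (\<Sum>n | 1 \<le> n \<and> real n \<le> x. f n)"

text \<open>
  Both integrals from \<open>1\<close> must exist. Moreover, a function bounding a remainder is understood to
  be (eventually) nonnegative, and the bound \<open>\<integral>\<^sub>1\<^sup>x g\<^sub>2(t) dt\<close> must be nonzero for large \<open>x\<close>: a Landau
  estimate as \<open>x \<rightarrow> \<infinity>\<close> says nothing about an initial segment \<open>[1, a]\<close>, which contributes a constant
  that cannot be absorbed if, say, \<open>g\<^sub>2\<close> is identically zero. Every locally integrable \<open>g\<^sub>2\<close> that is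
  positive on \<open>[1, \<infinity>)\<close> is admissible.
\<close>

definition admissible_main_term :: "(real \<Rightarrow> complex) \<Rightarrow> bool" where
  "admissible_main_term g1 \<longleftrightarrow> (\<forall>x\<ge>1. g1 integrable_on {1..x})"

definition admissible_remainder :: "(real \<Rightarrow> real) \<Rightarrow> bool" where
  "admissible_remainder g2 \<longleftrightarrow>
     (\<forall>x\<ge>1. g2 integrable_on {1..x}) \<and>
     (\<forall>\<^sub>F x in at_top. g2 x \<ge> 0) \<and>
     (\<forall>\<^sub>F x in at_top. integral {1..x} g2 > 0)"

end

theory Submission
  imports Defs
begin

text \<open>
  Abel summation gives \<open>\<Sum>\<^sub>n\<^sub>\<le>\<^sub>x n f(n) = x S(x) - \<integral>\<^sub>1\<^sup>x S(t) dt\<close> with \<open>S(x) = \<Sum>\<^sub>n\<^sub>\<le>\<^sub>x f(n)\<close>, so with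
  \<open>h = S - g\<^sub>1\<close> the two error terms are \<open>x h(x)\<close> and \<open>- \<integral>\<^sub>1\<^sup>x h(t) dt\<close>. In the latter, the part
  over an initial segment \<open>[1, A]\<close> is constant and is absorbed because \<open>\<integral>\<^sub>1\<^sup>x g\<^sub>2(t) dt\<close> is eventually
  nondecreasing and positive.
\<close>

text \<open>Viewed as a function of the upper limit \<open>t\<close>, the term \<open>f n\<close> is
  switched on exactly for \<open>t\<close> in \<open>{real n..x}\<close>, so it contributes
  \<open>(x - real n) *\<^sub>R f n\<close> to the integral. Adding these finitely many
  contributions yields Abel summation without any integration by parts.\<close>

lemma has_integral_summatory:
  assumes "x \<ge> 1"
  shows "(summatory f has_integral
           (complex_of_real x * summatory f x - summatory (\<lambda>n. of_nat n * f n) x)) {1..x}"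
proof -
  define N where "N = {n::nat. 1 \<le> n \<and> real n \<le> x}"
  have "N \<subseteq> {..nat \<lfloor>x\<rfloor>}"
    unfolding N_def by (auto simp: le_nat_floor)
  then have fin: "finite N"
    by (rule finite_subset) simp
  have "((\<lambda>t. if t \<in> {real n..x} then f n else 0) has_integral (x - real n) *\<^sub>R f n) {1..x}"
    if "n \<in> N" for n
  proof -
    have "{real n..x} \<subseteq> {1..x}" and "real n \<le> x"
      using that by (auto simp: N_def)
    then show ?thesis
      using has_integral_const_real[of "f n" "real n" x]
      by (subst has_integral_restrict) simp_all
  qed
  then have "((\<lambda>t. \<Sum>n\<in>N. if t \<in> {real n..x} then f n else 0) has_integral
               (\<Sum>n\<in>N. (x - real n) *\<^sub>R f n)) {1..x}"
    using fin by (intro has_integral_sum)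
  \<comment> \<open>The index set \<open>N\<close> is fixed by \<open>x\<close> and not by
    \<open>t\<close>; indices with \<open>t < real n\<close> only add zeros.\<close>
  moreover have "(\<Sum>n\<in>N. if t \<in> {real n..x} then f n else 0) = summatory f t"
    if "t \<in> {1..x}" for t
    unfolding summatory_def using fin that
    by (intro sum.mono_neutral_cong_right) (auto simp: N_def)
  ultimately have "(summatory f has_integral (\<Sum>n\<in>N. (x - real n) *\<^sub>R f n)) {1..x}"
    by (rule has_integral_eq[rotated])
  moreover have "(\<Sum>n\<in>N. (x - real n) *\<^sub>R f n) =
      complex_of_real x * summatory f x - summatory (\<lambda>n. of_nat n * f n) x"
    unfolding summatory_def N_def
    by (simp add: scaleR_conv_of_real algebra_simps sum_subtractf sum_distrib_left)
  ultimately show ?thesis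
    by simp
qed

text \<open>A Landau bound may be integrated from 1: past a threshold \<open>A\<close> the pointwise
  bound is integrated, and before it only the constant \<open>K\<close> arises, paid for by the
  factor \<open>K / G A\<close>.\<close>

lemma integral_bigo_admissible_remainder:
  fixes h :: "real \<Rightarrow> complex"
  assumes h_int: "\<And>x. x \<ge> 1 \<Longrightarrow> h integrable_on {1..x}"
    and adm: "admissible_remainder g"
    and bigo: "h \<in> O[at_top](\<lambda>x. complex_of_real (g x))"
  shows "(\<lambda>x. integral {1..x} h) \<in> O[at_top](\<lambda>x. complex_of_real (integral {1..x} g))"
proof -
  define G where "G x = integral {1..x} g" for x
  have g_int: "g integrable_on {1..x}" if "x \<ge> 1" for x
    using adm that by (simp add: admissible_remainder_def)
  obtain C where C: "C > 0" "\<forall>\<^sub>F x in at_top. norm (h x) \<le> C * norm (complex_of_real (g x))"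
    using landau_o.bigE[OF bigo] by blast
  have "\<forall>\<^sub>F x in at_top. norm (h x) \<le> C * norm (complex_of_real (g x)) \<and> g x \<ge> 0 \<and> G x > 0"
    using C(2) adm by (auto simp: admissible_remainder_def G_def eventually_conj_iff)
  then obtain A0 where
    A0: "\<And>x. x \<ge> A0 \<Longrightarrow> norm (h x) \<le> C * norm (complex_of_real (g x)) \<and> g x \<ge> 0 \<and> G x > 0"
    unfolding eventually_at_top_linorder by blast
  \<comment> \<open>The maximum with 1 allows every integral over \<open>{1..x}\<close> with
    \<open>x \<ge> A\<close> to be split at \<open>A\<close>.\<close>
  define A where "A = max 1 A0"
  have A1: "A \<ge> 1" and GA: "G A > 0" and g_nonneg: "\<And>t. t \<ge> A \<Longrightarrow> g t \<ge> 0"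
    and h_le: "\<And>t. t \<ge> A \<Longrightarrow> norm (h t) \<le> C * g t"
    using A0 by (force simp: A_def)+
  define K where "K = norm (integral {1..A} h)"
  have "norm (integral {1..x} h) \<le> (K / G A + C) * norm (complex_of_real (G x))" if x: "x \<ge> A" for x
  proof -
    have "h integrable_on {A..x}" and gAx: "g integrable_on {A..x}"
      using h_int[of x] g_int[of x] A1 x by (auto intro: integrable_on_subinterval)
    then have tail: "norm (integral {A..x} h) \<le> integral {A..x} (\<lambda>t. C * g t)"
      using h_le by (intro integral_norm_bound_integral integrable_on_mult_right) auto
    have split_h: "integral {1..A} h + integral {A..x} h = integral {1..x} h"
      using A1 x h_int[of x] by (intro Henstock_Kurzweil_Integration.integral_combine) auto
    have split_g: "G A + integral {A..x} g = G x"
      unfolding G_def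
      using A1 x g_int[of x] by (intro Henstock_Kurzweil_Integration.integral_combine) auto
    \<comment> \<open>Since \<open>g\<close> may be negative before \<open>A\<close>, monotonicity
      of \<open>G\<close> is available only from \<open>A\<close> on.\<close>
    have "integral {A..x} g \<ge> 0"
      using gAx g_nonneg by (intro integral_nonneg) auto
    then have GAx: "G A \<le> G x"
      using split_g by simp
    have "norm (integral {1..x} h) \<le> K + C * integral {A..x} g"
      using tail norm_triangle_ineq[of "integral {1..A} h" "integral {A..x} h"]
      by (simp add: K_def split_h)
    \<comment> \<open>The tail integral is \<open>G x - G A\<close>, and \<open>G A\<close> is
      positive.\<close>
    also have "\<dots> \<le> K + C * G x"
      using split_g GA C(1) by auto
    also have "K \<le> K / G A * G x"
      using GA GAx by (simp add: K_def field_simps mult_right_mono)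
    finally show ?thesis
      using GA GAx by (simp add: algebra_simps)
  qed
  then have "\<forall>\<^sub>F x in at_top. norm (integral {1..x} h) \<le> (K / G A + C) * norm (complex_of_real (G x))"
    using eventually_ge_at_top[of A] by (rule eventually_mono[rotated])
  then show ?thesis
    unfolding G_def by (rule landau_o.bigI[rotated]) (use GA C(1) in \<open>simp add: K_def G_def add_nonneg_pos\<close>)
qed

theorem mainTheorem4:
  fixes f :: "nat \<Rightarrow> complex" and g1 :: "real \<Rightarrow> complex" and g2 :: "real \<Rightarrow> real"
  assumes "admissible_main_term g1"
    and "admissible_remainder g2"
    and "(\<lambda>x. summatory f x - g1 x) \<in> O[at_top](\<lambda>x. complex_of_real (g2 x))"
  shows "\<exists>E1 E2 :: real \<Rightarrow> complex.
     E1 \<in> O[at_top](\<lambda>x. complex_of_real (x * g2 x)) \<and>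
     E2 \<in> O[at_top](\<lambda>x. complex_of_real (integral {1..x} g2)) \<and>
     (\<forall>x\<ge>1. summatory (\<lambda>n. of_nat n * f n) x =
        complex_of_real x * g1 x + E1 x - integral {1..x} g1 + E2 x)"
proof -
  define h where "h x = summatory f x - g1 x" for x
  have g1_int: "g1 integrable_on {1..x}" if "x \<ge> 1" for x
    using assms(1) that by (simp add: admissible_main_term_def)
  have S_int: "summatory f integrable_on {1..x}" if "x \<ge> 1" for x
    using has_integral_summatory[OF that] by blast
  have h_int: "h integrable_on {1..x}" if "x \<ge> 1" for x
    unfolding h_def using S_int g1_int that by (intro integrable_diff)
  have h_bigo: "h \<in> O[at_top](\<lambda>x. complex_of_real (g2 x))"
    using assms(3) by (simp add: h_def[abs_def])
  \<comment> \<open>The witnesses are \<open>E1 x = x * h x\<close> and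
    \<open>E2 x = - integral {1..x} h\<close>; with them the expansion is an exact identity for
    every \<open>x \<ge> 1\<close>.\<close>
  have "(\<lambda>x. complex_of_real x * h x) \<in> O[at_top](\<lambda>x. complex_of_real (x * g2 x))"
    using h_bigo by (simp add: landau_o.big.mult_left)
  moreover have "(\<lambda>x. - integral {1..x} h) \<in> O[at_top](\<lambda>x. complex_of_real (integral {1..x} g2))"
    using integral_bigo_admissible_remainder[OF h_int assms(2) h_bigo] by simp
  moreover have "summatory (\<lambda>n. of_nat n * f n) x =
      complex_of_real x * g1 x + complex_of_real x * h x - integral {1..x} g1 + - integral {1..x} h"
    if x: "x \<ge> 1" for x
  proof -
    have "integral {1..x} h = integral {1..x} (summatory f) - integral {1..x} g1"
      unfolding h_def using S_int[OF x] g1_int[OF x] by (rule integral_diff)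
    then show ?thesis
      using integral_unique[OF has_integral_summatory[OF x, of f]]
      by (simp add: h_def algebra_simps)
  qed
  ultimately show ?thesis
    by blast
qed

end
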